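(* Let $1 < p \leq 2$, let $a<b$ be real numbers, and let $f \in C([a,b]) \cap W^{1, \infty}((a,b))$ be semiconcave in $(a,b)$. Assume $\min_{x \in [a,b]} f(x) =f(a)=f(b)$, and that $f$ is differentiable in $(a, a+\epsilon) \cup (b-\epsilon, b)$ for some $\epsilon > 0$. Let $u$ be the constrained viscosity solution of $$u(x)+|u'(x)|^p -f(x) \leq 0 \ \text{ in } (a,b),\qquad u(x)+|u'(x)|^p- f(x) \geq 0\ \text{ on } [a, b].$$ (1) If $f'(x) = 0$ for all $x \in (a, a+\epsilon) \cup (b-\epsilon, b)$, then $u$ is semiconcave in $(a, b)$. (2) If $\dfrac{|f'(x)|}{\left(f(x) -f(b)\right)^{1/q}} \to +\infty$ as $x \to b$ (or as $x\to a$), where $q$ satisfies $\frac{1}{p}+\frac{1}{q}=1$, then $u$ is not semiconcave in $(a,b)$.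
   Context: Semiconcavity: a function $g$ is semiconcave in an open interval $I$ if there is a constant $K\ge 0$ with $g(x+h)+g(x-h)-2g(x)\le K|h|^2$ for all $x,h\in\mathbb{R}$ such that $\{x+sh:-1\le s\le 1\}\subset I$. Constrained viscosity solution: $u\in C([a,b])$ is the constrained viscosity solution of the problem if (i) whenever $\phi$ is $C^1$ and $u-\phi$ has a local maximum at $x_0\in(a,b)$, then $u(x_0)+|\phi'(x_0)|^p-f(x_0)\le 0$; and (ii) whenever $\phi\in C^1([a,b])$ and $u-\phi$ has a local minimum relative to $[a,b]$ at $x_0\in[a,b]$ (endpoints allowed), then $u(x_0)+|\phi'(x_0)|^p-f(x_0)\ge 0$. It exists and is unique. *)

theory Defs
  imports "HOL-Analysis.Analysis"
begin

definition semiconcave_on :: "real set \<Rightarrow> (real \<Rightarrow> real) \<Rightarrow> bool" where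
  "semiconcave_on I g \<longleftrightarrow>
     (\<exists>K\<ge>0. \<forall>x h. {x + s * h | s. -1 \<le> s \<and> s \<le> 1} \<subseteq> I \<longrightarrow>
        g (x + h) + g (x - h) - 2 * g x \<le> K * \<bar>h\<bar>\<^sup>2)"

definition test_function_on :: "real set \<Rightarrow> (real \<Rightarrow> real) \<Rightarrow> bool" where
  "test_function_on I \<phi> \<longleftrightarrow>
     (\<forall>n. (deriv ^^ n) \<phi> differentiable_on UNIV) \<and>
     compact (closure {x. \<phi> x \<noteq> 0}) \<and> closure {x. \<phi> x \<noteq> 0} \<subseteq> I"

definition ess_bounded_on :: "real set \<Rightarrow> (real \<Rightarrow> real) \<Rightarrow> bool" where
  "ess_bounded_on I g \<longleftrightarrow>
     g \<in> borel_measurable (lebesgue_on I) \<and> (\<exists>M. AE x in lebesgue_on I. \<bar>g x\<bar> \<le> M)"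

definition weak_deriv_on :: "real set \<Rightarrow> (real \<Rightarrow> real) \<Rightarrow> (real \<Rightarrow> real) \<Rightarrow> bool" where
  "weak_deriv_on I f g \<longleftrightarrow>
     (\<forall>\<phi>. test_function_on I \<phi> \<longrightarrow>
        (\<integral>x. f x * deriv \<phi> x \<partial>lebesgue_on I) = - (\<integral>x. g x * \<phi> x \<partial>lebesgue_on I))"

text \<open>The Sobolev space of essentially bounded functions on an open interval whose weak
  derivative is essentially bounded.\<close>

definition W1_infinity :: "real set \<Rightarrow> (real \<Rightarrow> real) set" where
  "W1_infinity I = {f. ess_bounded_on I f \<and> (\<exists>g. ess_bounded_on I g \<and> weak_deriv_on I f g)}"

text \<open>Derivatives are taken within \<open>S\<close>, hence one-sided at the endpoints of a closed interval;
  the library's \<open>C1_differentiable_on\<close> would require two-sided derivatives there.\<close>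

definition C1_with_deriv_on :: "real set \<Rightarrow> (real \<Rightarrow> real) \<Rightarrow> (real \<Rightarrow> real) \<Rightarrow> bool" where
  "C1_with_deriv_on S \<phi> \<phi>' \<longleftrightarrow>
     (\<forall>x\<in>S. (\<phi> has_real_derivative \<phi>' x) (at x within S)) \<and> continuous_on S \<phi>'"

definition local_max_within :: "real set \<Rightarrow> (real \<Rightarrow> real) \<Rightarrow> real \<Rightarrow> bool" where
  "local_max_within S w x0 \<longleftrightarrow> x0 \<in> S \<and> (\<exists>\<delta>>0. \<forall>x\<in>S. \<bar>x - x0\<bar> < \<delta> \<longrightarrow> w x \<le> w x0)"

definition local_min_within :: "real set \<Rightarrow> (real \<Rightarrow> real) \<Rightarrow> real \<Rightarrow> bool" where
  "local_min_within S w x0 \<longleftrightarrow> x0 \<in> S \<and> (\<exists>\<delta>>0. \<forall>x\<in>S. \<bar>x - x0\<bar> < \<delta> \<longrightarrow> w x0 \<le> w x)"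

definition constrained_viscosity_solution ::
    "real \<Rightarrow> (real \<Rightarrow> real) \<Rightarrow> real \<Rightarrow> real \<Rightarrow> (real \<Rightarrow> real) \<Rightarrow> bool" where
  "constrained_viscosity_solution p f a b u \<longleftrightarrow>
     continuous_on {a..b} u \<and>
     (\<forall>\<phi> \<phi>' x0. C1_with_deriv_on {a<..<b} \<phi> \<phi>' \<longrightarrow>
        local_max_within {a<..<b} (\<lambda>x. u x - \<phi> x) x0 \<longrightarrow>
        u x0 + \<bar>\<phi>' x0\<bar> powr p - f x0 \<le> 0) \<and>
     (\<forall>\<phi> \<phi>' x0. C1_with_deriv_on {a..b} \<phi> \<phi>' \<longrightarrow>
        local_min_within {a..b} (\<lambda>x. u x - \<phi> x) x0 \<longrightarrow>
        u x0 + \<bar>\<phi>' x0\<bar> powr p - f x0 \<ge> 0)"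

end

theory Submission
  imports Defs
begin

text \<open>Write \<open>m\<close> for the common boundary minimum of \<open>f\<close>. Testing with constants and with narrow
  parabolas gives \<open>m \<le> u \<le> f\<close>, so \<open>u = m\<close> at both ends and wherever \<open>f = m\<close>.

  If \<open>f = m\<close> near the ends, extending \<open>u\<close> and \<open>f\<close> by \<open>m\<close> gives a viscosity solution on the whole
  line. At a maximum of \<open>u x + u y - 2 u z - C ((x - y) / 2)\<^sup>2 - k (x + y - 2 z)\<^sup>2\<close> the momenta are
  \<open>P + e\<close>, \<open>P - e\<close> and \<open>P\<close>, so convexity of \<open>\<bar>P\<bar>\<^sup>p\<close> and the zeroth-order term transfer the
  semiconcavity constant of \<open>f\<close> to \<open>u\<close> as \<open>k\<close> tends to infinity.

  If \<open>\<bar>f'\<bar> / (f - m)\<^bsup>1/q\<^esup>\<close> blows up at \<open>b\<close>, then \<open>(f - m)\<^bsup>1/p\<^esup>\<close> has infinite slope there, that is,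
  \<open>f (b - s) - m \<ge> (N s)\<^sup>p\<close> for every \<open>N\<close> and small \<open>s\<close>. The slope of \<open>u\<close> at \<open>b\<close> vanishes because
  \<open>f b = m\<close>, so semiconcavity would force \<open>u (b - s) - m = O(s\<^sup>2)\<close>. Touching \<open>u\<close> from below near
  \<open>b - \<rho>\<close> by a parabola of slope \<open>O(\<rho>)\<close> gives \<open>f - m = O(\<rho>\<^sup>2 + \<rho>\<^sup>p) = O(\<rho>\<^sup>p)\<close> at a
  point at distance comparable to \<open>\<rho>\<close> from \<open>b\<close>, as \<open>p \<le> 2\<close>: a contradiction for large \<open>N\<close>.\<close>

section \<open>Convexity of the power and globally smooth test functions\<close>

text \<open>The mean of \<open>\<bar>P + e\<bar>\<close> and \<open>\<bar>P - e\<bar>\<close> is at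
  least \<open>\<bar>P\<bar>\<close>, so convexity of the power applies. Convexity is used on the
  open half-line; the case of a vanishing argument is computed directly.\<close>

lemma powr_add_diff_ge:
  fixes p P e :: real
  assumes "1 < p"
  shows "2 * \<bar>P\<bar> powr p \<le> \<bar>P + e\<bar> powr p + \<bar>P - e\<bar> powr p"
proof (cases "P + e = 0 \<or> P - e = 0")
  case True
  then have "e = P \<or> e = - P" by linarith
  then have "\<bar>P + e\<bar> powr p + \<bar>P - e\<bar> powr p = (2 * \<bar>P\<bar>) powr p"
    by (auto simp: abs_mult simp flip: mult_2)
  also have "\<dots> = 2 powr p * \<bar>P\<bar> powr p"
    by (simp add: powr_mult)
  also have "\<dots> \<ge> 2 powr 1 * \<bar>P\<bar> powr p"
    using assms by (intro mult_right_mono powr_mono) auto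
  finally show ?thesis by simp
next
  case False
  have conv: "convex_on {0<..} (\<lambda>x::real. x powr p)"
    using assms by (intro powr_convex) auto
  have "\<bar>P\<bar> powr p \<le> ((\<bar>P + e\<bar> + \<bar>P - e\<bar>) / 2) powr p"
    using assms by (intro powr_mono2) auto
  also have "\<dots> = ((1 - 1/2) *\<^sub>R \<bar>P + e\<bar> + (1/2) *\<^sub>R \<bar>P - e\<bar>) powr p"
    by (simp add: field_simps)
  also have "\<dots> \<le> (1 - 1/2) * \<bar>P + e\<bar> powr p + (1/2) * \<bar>P - e\<bar> powr p"
    by (rule convex_onD[OF conv]) (use False in auto)
  finally show ?thesis by simp
qed

text \<open>Restricting to test functions that are continuously differentiable on the whole line
  keeps derivatives within a set out of the comparison arguments.\<close>

lemma viscosity_sub: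
  assumes "constrained_viscosity_solution p f a b u"
    and "\<And>x. (\<phi> has_real_derivative \<phi>' x) (at x)" "continuous_on UNIV \<phi>'"
    and "x0 \<in> {a<..<b}" "\<delta> > 0"
    and "\<And>x. x \<in> {a<..<b} \<Longrightarrow> \<bar>x - x0\<bar> < \<delta> \<Longrightarrow> u x - \<phi> x \<le> u x0 - \<phi> x0"
  shows "u x0 + \<bar>\<phi>' x0\<bar> powr p \<le> f x0"
proof -
  have "C1_with_deriv_on {a<..<b} \<phi> \<phi>'"
    unfolding C1_with_deriv_on_def
    using assms(2,3) by (meson has_field_derivative_at_within continuous_on_subset subset_UNIV)
  moreover have "local_max_within {a<..<b} (\<lambda>x. u x - \<phi> x) x0"
    unfolding local_max_within_def using assms(4-6) by blast
  ultimately have "u x0 + \<bar>\<phi>' x0\<bar> powr p - f x0 \<le> 0"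
    using assms(1) unfolding constrained_viscosity_solution_def by blast
  then show ?thesis by simp
qed

lemma viscosity_super:
  assumes "constrained_viscosity_solution p f a b u"
    and "\<And>x. (\<phi> has_real_derivative \<phi>' x) (at x)" "continuous_on UNIV \<phi>'"
    and "x0 \<in> {a..b}" "\<delta> > 0"
    and "\<And>x. x \<in> {a..b} \<Longrightarrow> \<bar>x - x0\<bar> < \<delta> \<Longrightarrow> u x0 - \<phi> x0 \<le> u x - \<phi> x"
  shows "f x0 \<le> u x0 + \<bar>\<phi>' x0\<bar> powr p"
proof -
  have "C1_with_deriv_on {a..b} \<phi> \<phi>'"
    unfolding C1_with_deriv_on_def
    using assms(2,3) by (meson has_field_derivative_at_within continuous_on_subset subset_UNIV)
  moreover have "local_min_within {a..b} (\<lambda>x. u x - \<phi> x) x0"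
    unfolding local_min_within_def using assms(4-6) by blast
  ultimately have "u x0 + \<bar>\<phi>' x0\<bar> powr p - f x0 \<ge> 0"
    using assms(1) unfolding constrained_viscosity_solution_def by blast
  then show ?thesis by simp
qed

section \<open>Bounds of the solution by the minimum of \<open>f\<close> and by
  \<open>f\<close>\<close>

text \<open>A constant touches \<open>u\<close> from below at its minimum point, which may be an
  endpoint because the supersolution condition holds there too.\<close>

lemma viscosity_solution_ge:
  assumes sol: "constrained_viscosity_solution p f a b u" and "a < b"
    and m: "\<And>x. x \<in> {a..b} \<Longrightarrow> m \<le> f x" and x: "x \<in> {a..b}"
  shows "m \<le> u x"
proof -
  have "continuous_on {a..b} u"
    using sol by (simp add: constrained_viscosity_solution_def)
  then obtain x0 where x0: "x0 \<in> {a..b}" "\<forall>y\<in>{a..b}. u x0 \<le> u y"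
    using continuous_attains_inf[of "{a..b}" u] \<open>a < b\<close> by auto
  have "f x0 \<le> u x0 + \<bar>(\<lambda>_. 0) x0\<bar> powr p"
    by (rule viscosity_super[OF sol, of "\<lambda>_. 0" "\<lambda>_. 0" x0 1]) (use x0 in auto)
  then show ?thesis using m[OF x0(1)] x0(2) x by fastforce
qed

text \<open>If \<open>u > f\<close> at an interior point \<open>y\<close>, a steep parabola about
  \<open>y\<close> touches \<open>u\<close> from above at a nearby point where still
  \<open>u > f\<close>, against the subsolution inequality with its nonnegative power term.\<close>

lemma viscosity_solution_le:
  assumes sol: "constrained_viscosity_solution p f a b u" and "a < b"
    and cf: "continuous_on {a..b} f" and x: "x \<in> {a..b}"
  shows "u x \<le> f x"
proof -
  have cu: "continuous_on {a..b} u"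
    using sol by (simp add: constrained_viscosity_solution_def)
  have cd: "continuous_on {a..b} (\<lambda>x. u x - f x)"
    by (intro continuous_intros cu cf)
  have interior: "u y - f y \<le> 0" if y: "y \<in> {a<..<b}" for y
  proof (rule ccontr)
    assume neg: "\<not> u y - f y \<le> 0"
    have "isCont (\<lambda>x. u x - f x) y"
      using cd y continuous_on_interior[of "{a..b}" "\<lambda>x. u x - f x" y] by simp
    then have "eventually (\<lambda>x. u x - f x > 0) (at y)"
      using neg by (intro order_tendstoD(1)[of _ "u y - f y"]) (auto simp: isCont_def)
    then obtain d where d: "d > 0" "\<And>x. x \<noteq> y \<Longrightarrow> \<bar>x - y\<bar> < d \<Longrightarrow> u x - f x > 0"
      by (auto simp: eventually_at dist_real_def)
    define r where "r = min (d/2) (min ((y - a)/2) ((b - y)/2))"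
    have r: "r > 0" "r < d" "a < y - r" "y + r < b"
      using d y by (auto simp: r_def min_def field_simps)
    have cr: "continuous_on {y - r..y + r} u"
      by (rule continuous_on_subset[OF cu]) (use r in auto)
    obtain B where B: "\<And>x. x \<in> {y - r..y + r} \<Longrightarrow> u x \<le> B"
      using continuous_attains_sup[OF _ _ cr] r by force
    \<comment> \<open>This makes the parabola exceed \<open>B - u y\<close> by 1 at distance
      \<open>r\<close>, so the maximizer below is not an end of the window.\<close>
    define A where "A = (B - u y + 1) / r\<^sup>2"
    have A: "A * r\<^sup>2 = B - u y + 1" using r by (simp add: A_def)
    have "continuous_on {y - r..y + r} (\<lambda>x. u x - A * (x - y)\<^sup>2)"
      by (intro continuous_intros cr)
    then obtain x0 where x0: "x0 \<in> {y - r..y + r}"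
      "\<And>x. x \<in> {y - r..y + r} \<Longrightarrow> u x - A * (x - y)\<^sup>2 \<le> u x0 - A * (x0 - y)\<^sup>2"
      using continuous_attains_sup[of "{y - r..y + r}" "\<lambda>x. u x - A * (x - y)\<^sup>2"] r by force
    have "x0 \<noteq> y - r" "x0 \<noteq> y + r"
      using x0(2)[of y] B[of x0] x0(1) A r(1) by auto
    then have x0i: "y - r < x0" "x0 < y + r" using x0(1) by auto
    have "u x0 + \<bar>2 * A * (x0 - y)\<bar> powr p \<le> f x0"
    proof (rule viscosity_sub[OF sol, of "\<lambda>x. A * (x - y)\<^sup>2" "\<lambda>x. 2 * A * (x - y)" x0
          "min (x0 - (y - r)) (y + r - x0)"])
      show "((\<lambda>x. A * (x - y)\<^sup>2) has_real_derivative 2 * A * (x - y)) (at x)" for x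
        by (auto intro!: derivative_eq_intros)
      show "u x - A * (x - y)\<^sup>2 \<le> u x0 - A * (x0 - y)\<^sup>2"
        if "\<bar>x - x0\<bar> < min (x0 - (y - r)) (y + r - x0)" for x
        using that by (intro x0(2)) auto
    qed (use x0i r in \<open>auto intro!: continuous_intros\<close>)
    then have "u x0 - f x0 \<le> 0"
      by (smt (verit) powr_ge_zero)
    moreover have "u x0 - f x0 > 0"
      using d(2)[of x0] neg x0i r by (cases "x0 = y") auto
    ultimately show False by simp
  qed
  \<comment> \<open>The endpoints, where the subsolution inequality is not imposed, follow by
    continuity.\<close>
  have "u x - f x \<le> 0"
    by (rule continuous_le_on_closure[of "{a<..<b}"])
       (use cd x \<open>a < b\<close> interior in auto)
  then show ?thesis by simp
qed

section \<open>Semiconcavity for data flat near the ends\<close>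

text \<open>A third point \<open>z\<close>, tied to the midpoint by the penalty \<open>k\<close>,
  lets each variable move alone and so supply a test function. The bounds on \<open>U\<close> and
  its value \<open>m\<close> outside \<open>{a..b}\<close> confine the maximum of
  \<open>\<Phi>\<close> to a compact box. That maximum is global, so \<open>sub\<close> and
  \<open>super\<close> are only required at global extrema.\<close>

lemma semiconcave_solution_on_line:
  fixes U F :: "real \<Rightarrow> real"
  assumes p: "1 < p" and C: "C > 0"
    and contU: "continuous_on UNIV U" and Um: "\<And>x. m \<le> U x" and UB: "\<And>x. U x \<le> B"
    and Uout: "\<And>x. x \<notin> {a..b} \<Longrightarrow> U x = m"
    and ucF: "uniformly_continuous_on UNIV F"
    and scF: "\<And>x y. F x + F y - 2 * F ((x + y) / 2) \<le> C * ((x - y) / 2)\<^sup>2"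
    and sub: "\<And>\<phi> \<phi>' x0. (\<And>x. (\<phi> has_real_derivative \<phi>' x) (at x)) \<Longrightarrow> continuous_on UNIV \<phi>' \<Longrightarrow>
        (\<And>x. U x - \<phi> x \<le> U x0 - \<phi> x0) \<Longrightarrow> U x0 + \<bar>\<phi>' x0\<bar> powr p \<le> F x0"
    and super: "\<And>\<phi> \<phi>' x0. (\<And>x. (\<phi> has_real_derivative \<phi>' x) (at x)) \<Longrightarrow> continuous_on UNIV \<phi>' \<Longrightarrow>
        (\<And>x. U x0 - \<phi> x0 \<le> U x - \<phi> x) \<Longrightarrow> F x0 \<le> U x0 + \<bar>\<phi>' x0\<bar> powr p"
  shows "U x + U y - 2 * U ((x + y) / 2) \<le> C * ((x - y) / 2)\<^sup>2"
proof (rule ccontr)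
  assume viol: "\<not> ?thesis"
  define \<sigma> where "\<sigma> = U x + U y - 2 * U ((x + y) / 2) - C * ((x - y) / 2)\<^sup>2"
  have \<sigma>: "\<sigma> > 0" using viol by (simp add: \<sigma>_def)
  have mB: "m \<le> B" using Um[of 0] UB[of 0] by linarith
  \<comment> \<open>Replacing \<open>F z1\<close> by the value of \<open>F\<close> at the midpoint
    enters with weight 2, so an error below \<open>\<sigma> / 2\<close> costs less than
    \<open>\<sigma>\<close>.\<close>
  obtain \<eta> where \<eta>: "\<eta> > 0" "\<And>s t. \<bar>s - t\<bar> < \<eta> \<Longrightarrow> \<bar>F s - F t\<bar> < \<sigma> / 2"
    using ucF \<sigma> unfolding uniformly_continuous_on_def dist_real_def
    by (metis UNIV_I half_gt_zero abs_minus_commute)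
  \<comment> \<open>Positivity of \<open>\<Phi>\<close> bounds the penalty by
    \<open>2 * (B - m)\<close>. One fixed \<open>k\<close> of this size already puts
    \<open>z\<close> within \<open>\<eta>\<close> of the midpoint, so no limit in \<open>k\<close>
    is taken.\<close>
  define k where "k = 1 + 2 * (B - m) / (2 * \<eta>)\<^sup>2"
  have k: "k \<ge> 1" using mB by (simp add: k_def)
  have k\<eta>: "k * (2 * \<eta>)\<^sup>2 > 2 * (B - m)"
    using \<eta>(1) by (simp add: k_def field_simps)
  define \<Phi> where "\<Phi> x y z = U x + U y - 2 * U z - C * ((x - y) / 2)\<^sup>2 - k * (x + y - 2 * z)\<^sup>2" for x y z
  \<comment> \<open>A margin around \<open>{a..b}\<close> for which \<open>R\<^sup>2\<close> and
    \<open>C * (R / 2)\<^sup>2\<close> are both at least \<open>2 * (B - m)\<close>;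
    \<open>R \<le> R\<^sup>2\<close> takes the place of square roots.\<close>
  define R where "R = 8 * (B - m) / C + 2 * (B - m) + 1"
  have R1: "R \<ge> 1" using C mB by (simp add: R_def)
  have RR: "R \<le> R\<^sup>2" using R1 by (simp add: power2_eq_square)
  have R2: "R\<^sup>2 \<ge> 2 * (B - m)"
    using RR C mB unfolding R_def by (smt (verit) divide_nonneg_pos)
  have "C * R = 8 * (B - m) + C * (2 * (B - m) + 1)"
    using C by (simp add: R_def field_simps)
  then have "C * R \<ge> 8 * (B - m)" using C mB by simp
  moreover have "C * R \<le> C * R\<^sup>2" using RR C by simp
  ultimately have R3: "C * (R / 2)\<^sup>2 \<ge> 2 * (B - m)" by (simp add: power2_eq_square)
  define S where "S = {a - R..b + R} \<times> {a - R..b + R} \<times> {a - R..b + R}"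
  have inS: "(x, y, z) \<in> S \<and> \<bar>x + y - 2 * z\<bar> < 2 * \<eta>" if pos: "\<Phi> x y z > 0" for x y z
  proof -
    have bd: "U x + U y - 2 * U z \<le> 2 * (B - m)"
      using UB[of x] UB[of y] Um[of z] by (simp add: algebra_simps)
    have nn: "C * ((x - y) / 2)\<^sup>2 \<ge> 0" "k * (x + y - 2 * z)\<^sup>2 \<ge> 0" using C k by auto
    have "C * ((x - y) / 2)\<^sup>2 < C * (R / 2)\<^sup>2"
      using pos bd nn R3 unfolding \<Phi>_def by linarith
    then have "((x - y) / 2)\<^sup>2 < (R / 2)\<^sup>2" using C by simp
    then have "\<bar>(x - y) / 2\<bar> < R / 2"
      using R1 abs_le_square_iff[of "R / 2" "(x - y) / 2"] by linarith
    then have xy: "\<bar>x - y\<bar> < R" by simp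
    have kz: "k * (x + y - 2 * z)\<^sup>2 < 2 * (B - m)"
      using pos bd nn C unfolding \<Phi>_def by linarith
    have "(x + y - 2 * z)\<^sup>2 \<le> k * (x + y - 2 * z)\<^sup>2"
      using mult_right_mono[OF k, of "(x + y - 2 * z)\<^sup>2"] by simp
    then have "(x + y - 2 * z)\<^sup>2 < R\<^sup>2" using kz R2 by linarith
    then have xyz: "\<bar>x + y - 2 * z\<bar> < R"
      using R1 abs_le_square_iff[of R "x + y - 2 * z"] by linarith
    have "k * (x + y - 2 * z)\<^sup>2 < k * (2 * \<eta>)\<^sup>2" using kz k\<eta> by linarith
    then have "(x + y - 2 * z)\<^sup>2 < (2 * \<eta>)\<^sup>2" using k by simp
    then have xyz2: "\<bar>x + y - 2 * z\<bar> < 2 * \<eta>"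
      using \<eta>(1) abs_le_square_iff[of "2 * \<eta>" "x + y - 2 * z"] by linarith
    \<comment> \<open>Otherwise \<open>U x + U y = 2 * m \<le> 2 * U z\<close>, and
      \<open>\<Phi>\<close> is not positive. A point in \<open>{a..b}\<close> anchors the other two
      within \<open>R\<close>.\<close>
    have "x \<in> {a..b} \<or> y \<in> {a..b}"
    proof (rule ccontr)
      assume "\<not> ?thesis"
      then have "U x = m" "U y = m" using Uout by auto
      then show False using pos nn Um[of z] unfolding \<Phi>_def by linarith
    qed
    then show ?thesis using xy xyz xyz2 R1 unfolding S_def by auto
  qed
  have \<Phi>0: "\<Phi> x y ((x + y) / 2) = \<sigma>" by (simp add: \<Phi>_def \<sigma>_def)
  have "S \<noteq> {}" using inS[of x y "(x + y) / 2"] \<Phi>0 \<sigma> by auto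
  moreover have "compact S" unfolding S_def by (intro compact_Times compact_Icc)
  moreover have "continuous_on S (\<lambda>(x, y, z). \<Phi> x y z)"
    unfolding \<Phi>_def case_prod_unfold
    by (intro continuous_intros continuous_on_compose2[OF contU]) auto
  ultimately obtain w where w: "w \<in> S" "\<forall>v\<in>S. (\<lambda>(x, y, z). \<Phi> x y z) v \<le> (\<lambda>(x, y, z). \<Phi> x y z) w"
    using continuous_attains_sup by metis
  obtain x1 y1 z1 where w_eq: "w = (x1, y1, z1)" using prod_cases3 by blast
  have inmax: "\<Phi> x y z \<le> \<Phi> x1 y1 z1" if "(x, y, z) \<in> S" for x y z
    using w(2) that w_eq by force
  have ge\<sigma>: "\<Phi> x1 y1 z1 \<ge> \<sigma>"
    using inmax[of x y "(x + y) / 2"] inS[of x y "(x + y) / 2"] \<Phi>0 \<sigma> by simp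
  have maxi: "\<Phi> x y z \<le> \<Phi> x1 y1 z1" for x y z
    using inmax[of x y z] inS[of x y z] ge\<sigma> \<sigma> by (cases "\<Phi> x y z > 0") auto
  define P where "P = 2 * k * (x1 + y1 - 2 * z1)"
  define e where "e = C * (x1 - y1) / 2"
  have sx: "U x1 + \<bar>P + e\<bar> powr p \<le> F x1"
  proof -
    have "U x1 + \<bar>C * (x1 - y1) / 2 + 2 * k * (x1 + y1 - 2 * z1)\<bar> powr p \<le> F x1"
    proof (rule sub[of "\<lambda>t. C * ((t - y1) / 2)\<^sup>2 + k * (t + y1 - 2 * z1)\<^sup>2"
          "\<lambda>t. C * (t - y1) / 2 + 2 * k * (t + y1 - 2 * z1)"])
      show "U t - (C * ((t - y1) / 2)\<^sup>2 + k * (t + y1 - 2 * z1)\<^sup>2) \<le>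
          U x1 - (C * ((x1 - y1) / 2)\<^sup>2 + k * (x1 + y1 - 2 * z1)\<^sup>2)" for t
        using maxi[of t y1 z1] unfolding \<Phi>_def by linarith
    qed (auto intro!: derivative_eq_intros continuous_intros simp: field_simps)
    then show ?thesis by (simp add: P_def e_def add.commute)
  qed
  have sy: "U y1 + \<bar>P - e\<bar> powr p \<le> F y1"
  proof -
    have "U y1 + \<bar>2 * k * (x1 + y1 - 2 * z1) - C * (x1 - y1) / 2\<bar> powr p \<le> F y1"
    proof (rule sub[of "\<lambda>t. C * ((x1 - t) / 2)\<^sup>2 + k * (x1 + t - 2 * z1)\<^sup>2"
          "\<lambda>t. 2 * k * (x1 + t - 2 * z1) - C * (x1 - t) / 2"])
      show "U t - (C * ((x1 - t) / 2)\<^sup>2 + k * (x1 + t - 2 * z1)\<^sup>2) \<le>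
          U y1 - (C * ((x1 - y1) / 2)\<^sup>2 + k * (x1 + y1 - 2 * z1)\<^sup>2)" for t
        using maxi[of x1 t z1] unfolding \<Phi>_def by linarith
    qed (auto intro!: derivative_eq_intros continuous_intros simp: field_simps)
    then show ?thesis by (simp add: P_def e_def)
  qed
  \<comment> \<open>\<open>\<Phi>\<close> contains \<open>2 * U z\<close>, so maximality in
    \<open>z\<close> is halved; hence the factor \<open>k / 2\<close>, which makes the slope exactly
    \<open>P\<close>.\<close>
  have sz: "F z1 \<le> U z1 + \<bar>P\<bar> powr p"
    unfolding P_def
  proof (rule super[of "\<lambda>t. - (k / 2) * (x1 + y1 - 2 * t)\<^sup>2" "\<lambda>t. 2 * k * (x1 + y1 - 2 * t)"])
    show "U z1 - - (k / 2) * (x1 + y1 - 2 * z1)\<^sup>2 \<le> U t - - (k / 2) * (x1 + y1 - 2 * t)\<^sup>2" for t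
      using maxi[of x1 y1 t] unfolding \<Phi>_def by (simp add: field_simps)
  qed (auto intro!: derivative_eq_intros continuous_intros simp: field_simps)
  have "\<bar>x1 + y1 - 2 * z1\<bar> < 2 * \<eta>" using inS[of x1 y1 z1] ge\<sigma> \<sigma> by simp
  then have "\<bar>(x1 + y1) / 2 - z1\<bar> < \<eta>" by (simp add: abs_if field_simps split: if_splits)
  then have "\<bar>F ((x1 + y1) / 2) - F z1\<bar> < \<sigma> / 2" by (rule \<eta>(2))
  moreover have "k * (x1 + y1 - 2 * z1)\<^sup>2 \<ge> 0" using k by simp
  \<comment> \<open>The powers drop out by convexity, leaving the second difference of
    \<open>U\<close> strictly below \<open>C * ((x1 - y1) / 2)\<^sup>2 + \<sigma>\<close>, against
    \<open>\<Phi> x1 y1 z1 \<ge> \<sigma>\<close>.\<close>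
  ultimately show False
    using sx sy sz powr_add_diff_ge[OF p, of P e] scF[of x1 y1] ge\<sigma> unfolding \<Phi>_def by linarith
qed

text \<open>The extensions of \<open>u\<close> and \<open>f\<close> both equal \<open>m\<close> near
  and beyond the ends, so the equation holds trivially there and the boundary disappears.\<close>

lemma semiconcave_solution_if_flat_near_ends:
  assumes p: "1 < p" and ab: "a < b" and cf: "continuous_on {a..b} f"
    and sc: "semiconcave_on {a<..<b} f"
    and m: "\<And>x. x \<in> {a..b} \<Longrightarrow> m \<le> f x"
    and \<eta>: "\<eta> > 0" and flat: "\<And>x. x \<in> {a..b} \<Longrightarrow> x < a + \<eta> \<or> b - \<eta> < x \<Longrightarrow> f x = m"
    and sol: "constrained_viscosity_solution p f a b u"
  shows "semiconcave_on {a<..<b} u"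
proof -
  \<comment> \<open>Clamping is 1-Lipschitz onto \<open>{a..b}\<close>, so composing with it
    preserves continuity and gives uniform continuity of \<open>F\<close>.\<close>
  define c where "c x = max a (min b x)" for x
  have c_in: "c x \<in> {a..b}" for x using ab by (auto simp: c_def)
  have c_id: "c x = x" if "x \<in> {a..b}" for x using that by (auto simp: c_def)
  have c_lip: "\<bar>c x - c y\<bar> \<le> \<bar>x - y\<bar>" for x y by (auto simp: c_def max_def min_def)
  have cc: "continuous_on UNIV c" unfolding c_def by (intro continuous_intros)
  define F where "F x = f (c x)" for x
  define U where "U x = u (c x)" for x
  have cu: "continuous_on {a..b} u"
    using sol by (simp add: constrained_viscosity_solution_def)
  have u_ge: "m \<le> u x" if "x \<in> {a..b}" for x
    using viscosity_solution_ge[OF sol ab m that] .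
  have u_le: "u x \<le> f x" if "x \<in> {a..b}" for x
    using viscosity_solution_le[OF sol ab cf that] .
  obtain B where B: "\<And>x. x \<in> {a..b} \<Longrightarrow> f x \<le> B"
    using continuous_attains_sup[OF _ _ cf] ab by force
  have mB: "m \<le> B" using B[of a] m[of a] ab by simp
  obtain K where K: "K \<ge> 0" and
    Kf: "\<And>x h. {x + s * h |s. - 1 \<le> s \<and> s \<le> 1} \<subseteq> {a<..<b} \<Longrightarrow>
        f (x + h) + f (x - h) - 2 * f x \<le> K * \<bar>h\<bar>\<^sup>2"
    using sc unfolding semiconcave_on_def by blast
  \<comment> \<open>If the half-distance of \<open>x\<close> and \<open>y\<close> is below
    \<open>\<theta>\<close>, they are closer than \<open>\<eta>\<close>; when one lies outside the
    open interval, both lie in the flat zone.\<close>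
  define \<theta> where "\<theta> = \<eta> / 2"
  have \<theta>: "\<theta> > 0" "2 * \<theta> = \<eta>" using \<eta> by (auto simp: \<theta>_def)
  \<comment> \<open>\<open>K\<close> serves close pairs inside the interval. The middle term serves
    half-distances of at least \<open>\<theta>\<close>, where the crude bound
    \<open>2 * (B - m)\<close> suffices. The 1 makes \<open>C\<close> positive.\<close>
  define C where "C = K + 2 * (B - m) / \<theta>\<^sup>2 + 1"
  have CK: "C \<ge> K" and C0: "C > 0" using K mB by (auto simp: C_def add_nonneg_pos)
  have CB: "2 * (B - m) \<le> C * \<theta>\<^sup>2"
    using K \<theta> by (simp add: C_def field_simps)
  have F_ge: "m \<le> F x" and F_le: "F x \<le> B" and U_ge: "m \<le> U x" and U_leF: "U x \<le> F x" for x
    using m B u_ge u_le c_in by (auto simp: F_def U_def)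
  have F_flat: "F x = m" if "x < a + \<eta> \<or> b - \<eta> < x" for x
    unfolding F_def using that \<eta> ab by (intro flat c_in) (auto simp: c_def)
  have U_flat: "U x = m" if "x < a + \<eta> \<or> b - \<eta> < x" for x
    using F_flat[OF that] U_ge[of x] U_leF[of x] by simp
  have scF: "F x + F y - 2 * F ((x + y) / 2) \<le> C * ((x - y) / 2)\<^sup>2" for x y
  proof (cases "\<bar>(x - y) / 2\<bar> < \<theta>")
    case False
    have "\<theta>\<^sup>2 \<le> ((x - y) / 2)\<^sup>2"
      using False \<theta>(1) by (intro abs_le_square_iff[THEN iffD1]) auto
    then have "C * \<theta>\<^sup>2 \<le> C * ((x - y) / 2)\<^sup>2" using C0 by simp
    moreover have "F x + F y - 2 * F ((x + y) / 2) \<le> 2 * (B - m)"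
      using F_ge[of "(x + y) / 2"] F_le[of x] F_le[of y] by (simp add: algebra_simps)
    ultimately show ?thesis using CB by linarith
  next
    case True
    show ?thesis
    proof (cases "x \<in> {a<..<b} \<and> y \<in> {a<..<b}")
      case xy: True
      have "{(x + y) / 2 + s * ((x - y) / 2) |s. - 1 \<le> s \<and> s \<le> 1} \<subseteq> {a<..<b}"
      proof clarify
        fix s :: real assume s: "- 1 \<le> s" "s \<le> 1"
        have eq: "(x + y) / 2 + s * ((x - y) / 2) = (1 - (1 + s) / 2) *\<^sub>R y + ((1 + s) / 2) *\<^sub>R x"
          by (simp add: field_simps)
        show "(x + y) / 2 + s * ((x - y) / 2) \<in> {a<..<b}"
          unfolding eq using s xy by (intro convexD_alt[of "{a<..<b}" y x]) auto
      qed
      from Kf[OF this] have "f x + f y - 2 * f ((x + y) / 2) \<le> K * ((x - y) / 2)\<^sup>2"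
        by (simp add: field_simps)
      also have "\<dots> \<le> C * ((x - y) / 2)\<^sup>2" using CK by (intro mult_right_mono) auto
      finally show ?thesis using xy by (simp add: F_def c_id)
    next
      case False
      have "F x = m" "F y = m"
        using False True \<theta> \<eta> by (intro F_flat; auto simp: abs_if field_simps split: if_splits)+
      then show ?thesis using F_ge[of "(x + y) / 2"] C0
        by (smt (verit) mult_nonneg_nonneg zero_le_power2)
    qed
  qed
  have ucF: "uniformly_continuous_on UNIV F"
  proof -
    have "uniformly_continuous_on UNIV c"
      unfolding uniformly_continuous_on_def dist_real_def using c_lip by (meson order_le_less_trans)
    moreover have "c ` UNIV = {a..b}"
      using c_in c_id by (metis image_subset_iff rangeI subset_antisym subsetI UNIV_I)
    then have "uniformly_continuous_on (c ` UNIV) f"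
      using compact_uniformly_continuous[OF cf] by simp
    ultimately show ?thesis
      unfolding F_def using uniformly_continuous_on_compose[of UNIV c f] by (simp add: o_def)
  qed
  have contU: "continuous_on UNIV U"
    unfolding U_def by (rule continuous_on_compose2[OF cu cc]) (use c_in in auto)
  have sub: "U x0 + \<bar>\<phi>' x0\<bar> powr p \<le> F x0"
    if d: "\<And>x. (\<phi> has_real_derivative \<phi>' x) (at x)" and c': "continuous_on UNIV \<phi>'"
      and mx: "\<And>x. U x - \<phi> x \<le> U x0 - \<phi> x0" for \<phi> \<phi>' x0
  proof (cases "x0 \<in> {a<..<b}")
    case True
    have "u x0 + \<bar>\<phi>' x0\<bar> powr p \<le> f x0"
    proof (rule viscosity_sub[OF sol d c' True, of 1])
      show "u x - \<phi> x \<le> u x0 - \<phi> x0" if "x \<in> {a<..<b}" for x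
        using mx[of x] that True by (simp add: U_def c_id)
    qed auto
    then show ?thesis using True by (simp add: U_def F_def c_id)
  next
    case False
    \<comment> \<open>\<open>U\<close> is constant near such a point, so \<open>\<phi>\<close> has a
      local minimum there and its slope vanishes.\<close>
    have loc: "U x = m" if "\<bar>x0 - x\<bar> < \<eta>" for x
      using False that by (intro U_flat) auto
    have "\<phi>' x0 = 0"
    proof (rule DERIV_local_min[OF d \<eta>], intro allI impI)
      fix y assume "\<bar>x0 - y\<bar> < \<eta>"
      then show "\<phi> x0 \<le> \<phi> y" using mx[of y] loc[of y] loc[of x0] \<eta> by simp
    qed
    then show ?thesis using U_leF[of x0] by simp
  qed
  have super: "F x0 \<le> U x0 + \<bar>\<phi>' x0\<bar> powr p"
    if d: "\<And>x. (\<phi> has_real_derivative \<phi>' x) (at x)" and c': "continuous_on UNIV \<phi>'"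
      and mn: "\<And>x. U x0 - \<phi> x0 \<le> U x - \<phi> x" for \<phi> \<phi>' x0
  proof (cases "x0 \<in> {a<..<b}")
    case True
    have "f x0 \<le> u x0 + \<bar>\<phi>' x0\<bar> powr p"
    proof (rule viscosity_super[OF sol d c', of x0 1])
      show "u x0 - \<phi> x0 \<le> u x - \<phi> x" if "x \<in> {a..b}" for x
        using mn[of x] that True by (simp add: U_def c_id)
    qed (use True in auto)
    then show ?thesis using True by (simp add: U_def F_def c_id)
  next
    case False
    then have "F x0 = m" "U x0 = m" using \<eta> by (auto intro!: F_flat U_flat)
    then show ?thesis by simp
  qed
  have main: "U x + U y - 2 * U ((x + y) / 2) \<le> C * ((x - y) / 2)\<^sup>2" for x y
  proof (rule semiconcave_solution_on_line[OF p C0 contU U_ge _ _ ucF scF, of B a b])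
    show "U x \<le> B" for x using U_leF[of x] F_le[of x] by linarith
    show "U x = m" if "x \<notin> {a..b}" for x using that \<eta> by (intro U_flat) auto
  qed (use sub super in blast)+
  show ?thesis
    unfolding semiconcave_on_def
  proof (intro exI[of _ C] conjI allI impI)
    fix x h assume sub: "{x + s * h |s. - 1 \<le> s \<and> s \<le> 1} \<subseteq> {a<..<b}"
    have "x + s * h \<in> {a<..<b}" if "- 1 \<le> s" "s \<le> 1" for s using sub that by blast
    from this[of 0] this[of 1] this[of "-1"]
    have "x \<in> {a..b}" "x + h \<in> {a..b}" "x - h \<in> {a..b}" by auto
    then show "u (x + h) + u (x - h) - 2 * u x \<le> C * \<bar>h\<bar>\<^sup>2"
      using main[of "x + h" "x - h"] by (simp add: U_def c_id)
  qed (use C0 in simp)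
qed

section \<open>Failure of semiconcavity for data steep at the right end\<close>

text \<open>Iterated halving sums the geometric series
  \<open>K / 4 * (1 + 1/2 + 1/4 + ...) = K / 2\<close> and leaves
  \<open>2 ^ n * v (s / 2 ^ n)\<close>, whose upper limit the slope hypothesis makes arbitrarily
  small.\<close>

lemma parabola_bound_from_halving:
  fixes v :: "real \<Rightarrow> real"
  assumes K: "K \<ge> 0"
    and half: "\<And>s. 0 \<le> s \<Longrightarrow> s \<le> l \<Longrightarrow> v s \<le> 2 * v (s / 2) + K * (s / 2)\<^sup>2"
    and slope: "\<And>c. c > 0 \<Longrightarrow> \<exists>B r. r > 0 \<and> (\<forall>s\<in>{0..r}. v s \<le> c * s + B * s\<^sup>2)"
    and s: "0 \<le> s" "s \<le> l"
  shows "v s \<le> K / 2 * s\<^sup>2"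
proof -
  have iter: "v s \<le> 2 ^ n * v (s / 2 ^ n) + K / 2 * s\<^sup>2 * (1 - (1/2) ^ n)" for n
  proof (induction n)
    case (Suc n)
    have "s / 2 ^ n \<le> s" using s mult_left_mono[of 1 "2 ^ n" s] by (simp add: field_simps)
    then have "v (s / 2 ^ n) \<le> 2 * v (s / 2 ^ n / 2) + K * (s / 2 ^ n / 2)\<^sup>2"
      using s by (intro half) auto
    then have "2 ^ n * v (s / 2 ^ n) \<le> 2 ^ n * (2 * v (s / 2 ^ n / 2) + K * (s / 2 ^ n / 2)\<^sup>2)"
      by (intro mult_left_mono) auto
    also have "\<dots> = 2 ^ Suc n * v (s / 2 ^ Suc n) + K / 2 * s\<^sup>2 * ((1/2) ^ n - (1/2) ^ Suc n)"
      by (simp add: field_simps power2_eq_square power_divide)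
    finally have "2 ^ n * v (s / 2 ^ n) \<le>
      2 ^ Suc n * v (s / 2 ^ Suc n) + K / 2 * s\<^sup>2 * ((1/2) ^ n - (1/2) ^ Suc n)" .
    moreover have "K / 2 * s\<^sup>2 * (1 - (1/2) ^ Suc n) =
      K / 2 * s\<^sup>2 * (1 - (1/2) ^ n) + K / 2 * s\<^sup>2 * ((1/2) ^ n - (1/2) ^ Suc n)"
      by (simp add: field_simps)
    ultimately show ?case using Suc.IH by linarith
  qed simp
  have "v s \<le> K / 2 * s\<^sup>2 + e" if e: "e > 0" for e
  proof -
    \<comment> \<open>The added 1 covers \<open>s = 0\<close>.\<close>
    define c where "c = e / (s + 1)"
    have c: "c > 0" "c * s \<le> e" using e s by (auto simp: c_def field_simps)
    obtain B r where r: "r > 0" "\<forall>t\<in>{0..r}. v t \<le> c * t + B * t\<^sup>2" using slope[OF c(1)] by blast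
    have lim: "(\<lambda>n. s * (1/2) ^ n) \<longlonglongrightarrow> s * 0"
      by (intro tendsto_intros LIMSEQ_power_zero) auto
    then have "eventually (\<lambda>n. s * (1/2) ^ n < r) sequentially"
      using r(1) by (intro order_tendstoD(2)[where y = "s * 0"]) auto
    \<comment> \<open>\<open>B\<close> may depend on \<open>c\<close>, but both are fixed while
      \<open>n\<close> grows, so the quadratic part vanishes with \<open>(1/2) ^ n\<close>.\<close>
    then have ev: "eventually (\<lambda>n. v s \<le> c * s + B * s\<^sup>2 * (1/2) ^ n + K / 2 * s\<^sup>2 * (1 - (1/2) ^ n)) sequentially"
    proof eventually_elim
      case (elim n)
      then have "s / 2 ^ n \<in> {0..r}" using s by (simp add: power_divide)
      then have "v (s / 2 ^ n) \<le> c * (s / 2 ^ n) + B * (s / 2 ^ n)\<^sup>2"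
        using r(2) by blast
      then have "2 ^ n * v (s / 2 ^ n) \<le> 2 ^ n * (c * (s / 2 ^ n) + B * (s / 2 ^ n)\<^sup>2)"
        by (intro mult_left_mono) auto
      also have "\<dots> = c * s + B * s\<^sup>2 * (1/2) ^ n"
        by (simp add: field_simps power2_eq_square power_divide)
      finally show ?case using iter[of n] by linarith
    qed
    have "(\<lambda>n. c * s + B * s\<^sup>2 * (1/2) ^ n + K / 2 * s\<^sup>2 * (1 - (1/2) ^ n))
        \<longlonglongrightarrow> c * s + B * s\<^sup>2 * 0 + K / 2 * s\<^sup>2 * (1 - 0)"
      by (intro tendsto_intros LIMSEQ_power_zero) auto
    from tendsto_lowerbound[OF this ev] show ?thesis using c(2) by simp
  qed
  then show ?thesis by (rule field_le_epsilon)
qed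

text \<open>A barrier argument: near \<open>b\<close>, \<open>f\<close> is less than
  \<open>c powr p\<close> above \<open>m\<close>, so by \<open>u \<ge> m\<close> the subsolution
  inequality forbids touching from above with slope of modulus at least \<open>c\<close>. The
  maximum of \<open>u\<close> minus the barrier must then sit at \<open>b\<close>.\<close>

lemma viscosity_solution_slope_right:
  assumes p: "1 < p" and ab: "a < b" and cf: "continuous_on {a..b} f"
    and sol: "constrained_viscosity_solution p f a b u"
    and fb: "f b = m" and um: "\<And>x. x \<in> {a..b} \<Longrightarrow> m \<le> u x" and ub: "u b = m" and c: "c > 0"
  shows "\<exists>B r. r > 0 \<and> (\<forall>s\<in>{0..r}. u (b - s) - m \<le> c * s + B * s\<^sup>2)"
proof -
  have cu: "continuous_on {a..b} u"
    using sol by (simp add: constrained_viscosity_solution_def)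
  have "c powr p > 0" using c by simp
  then obtain d where d: "d > 0" "\<And>x. x \<in> {a..b} \<Longrightarrow> \<bar>x - b\<bar> < d \<Longrightarrow> \<bar>f x - f b\<bar> < c powr p"
    using cf ab unfolding continuous_on_iff dist_real_def by (meson atLeastAtMost_iff order.refl less_imp_le)
  define r where "r = min (d / 2) ((b - a) / 2)"
  have r: "r > 0" "r < d" "a < b - r" using d ab by (auto simp: r_def min_def field_simps)
  obtain D where D: "\<And>x. x \<in> {a..b} \<Longrightarrow> u x \<le> D"
    using continuous_attains_sup[OF _ _ cu] ab by force
  have mD: "m \<le> D" using D[of b] ub ab by simp
  \<comment> \<open>This lifts the barrier at \<open>b - r\<close> above \<open>D - m\<close>, which
    excludes the left end as maximizer; \<open>B \<ge> 0\<close> keeps the modulus of the slope at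
    least \<open>c\<close>.\<close>
  define B where "B = (D - m) / r\<^sup>2"
  have B: "B * r\<^sup>2 = D - m" "B \<ge> 0" using r mD by (auto simp: B_def)
  define \<phi> where "\<phi> x = c * (b - x) + B * (b - x)\<^sup>2" for x
  have "continuous_on {b - r..b} (\<lambda>x. u x - \<phi> x)"
    unfolding \<phi>_def using r by (intro continuous_intros continuous_on_subset[OF cu]) auto
  then obtain x0 where x0: "x0 \<in> {b - r..b}"
    "\<And>x. x \<in> {b - r..b} \<Longrightarrow> u x - \<phi> x \<le> u x0 - \<phi> x0"
    using continuous_attains_sup[of "{b - r..b}" "\<lambda>x. u x - \<phi> x"] r by force
  have \<phi>b: "\<phi> b = 0" by (simp add: \<phi>_def)
  have "x0 = b"
  proof (rule ccontr)
    assume "x0 \<noteq> b"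
    then have lt: "x0 < b" using x0(1) by auto
    have "c * r > 0" using c r by simp
    then have "u (b - r) - \<phi> (b - r) < m"
      using D[of "b - r"] r B(1) by (simp add: \<phi>_def)
    then have "x0 \<noteq> b - r" using x0(2)[of b] ub \<phi>b r by auto
    then have gt: "b - r < x0" using x0(1) by auto
    have "u x0 + \<bar>- c - 2 * B * (b - x0)\<bar> powr p \<le> f x0"
    proof (rule viscosity_sub[OF sol, of \<phi> "\<lambda>x. - c - 2 * B * (b - x)" x0 "min (x0 - (b - r)) (b - x0)"])
      show "(\<phi> has_real_derivative - c - 2 * B * (b - x)) (at x)" for x
        unfolding \<phi>_def by (auto intro!: derivative_eq_intros simp: algebra_simps)
      show "u x - \<phi> x \<le> u x0 - \<phi> x0" if "\<bar>x - x0\<bar> < min (x0 - (b - r)) (b - x0)" for x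
        using that by (intro x0(2)) auto
    qed (use lt gt r in \<open>auto intro!: continuous_intros\<close>)
    moreover have "2 * B * (b - x0) \<ge> 0" using B(2) lt by simp
    then have "c powr p \<le> \<bar>- c - 2 * B * (b - x0)\<bar> powr p"
      using c p by (intro powr_mono2) auto
    moreover have "m \<le> u x0" using um[of x0] lt gt r by auto
    moreover have "f x0 - f b < c powr p" using d(2)[of x0] lt gt r by auto
    ultimately show False using fb by linarith
  qed
  then have "u (b - s) - m \<le> c * s + B * s\<^sup>2" if "s \<in> {0..r}" for s
    using x0(2)[of "b - s"] that ub \<phi>b by (auto simp: \<phi>_def)
  then show ?thesis using r(1) by blast
qed

text \<open>The segment reaches \<open>b\<close>, outside the open interval. Steps
  \<open>h < s / 2\<close> are admissible, and continuity carries the inequality to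
  \<open>s / 2\<close>.\<close>

lemma semiconcave_halving_right:
  fixes u :: "real \<Rightarrow> real"
  assumes cu: "continuous_on {a..b} u" and "K \<ge> 0"
    and Ku: "\<And>x h. {x + s * h |s. - 1 \<le> s \<and> s \<le> 1} \<subseteq> {a<..<b} \<Longrightarrow>
        u (x + h) + u (x - h) - 2 * u x \<le> K * \<bar>h\<bar>\<^sup>2"
    and s: "0 \<le> s" "s \<le> b - a"
  shows "u (b - s) + u b - 2 * u (b - s / 2) \<le> K * (s / 2)\<^sup>2"
proof (cases "s = 0")
  case False
  then have s0: "s > 0" using s by simp
  define g where "g h = u (b - s / 2 - h) + u (b - s / 2 + h) - 2 * u (b - s / 2) - K * h\<^sup>2" for h
  have cg: "continuous_on (closure {0<..<s / 2}) g"
    unfolding g_def using s s0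
    by (intro continuous_intros continuous_on_compose2[OF cu]) auto
  have "g (s / 2) \<le> 0"
  proof (rule continuous_le_on_closure[OF cg])
    show "s / 2 \<in> closure {0<..<s / 2}" using s0 by simp
    fix h assume h: "h \<in> {0<..<s / 2}"
    have "{b - s / 2 + t * h |t. - 1 \<le> t \<and> t \<le> 1} \<subseteq> {a<..<b}"
    proof clarify
      fix t :: real assume "- 1 \<le> t" "t \<le> 1"
      then have "\<bar>t * h\<bar> \<le> 1 * h" using h by (simp only: abs_mult) (intro mult_mono; auto)
      then have "\<bar>t * h\<bar> < s / 2" using h by simp
      then show "b - s / 2 + t * h \<in> {a<..<b}" using s by (auto simp: abs_if split: if_splits)
    qed
    from Ku[OF this] show "g h \<le> 0" by (simp add: g_def)
  qed
  moreover have "b - s / 2 - s / 2 = b - s" by simp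
  ultimately show ?thesis unfolding g_def by simp
qed simp

text \<open>As \<open>1 / p - 1 = - (1 / q)\<close>, the quotient in \<open>lim\<close> is
  \<open>p\<close> times the modulus of the derivative of \<open>(f x - f b) powr (1 / p)\<close>;
  the mean value theorem turns its growth into a linear lower bound for this root.\<close>

lemma steep_root_lower_bound:
  fixes f :: "real \<Rightarrow> real"
  assumes p: "1 < p" and pq: "1 / p + 1 / q = 1" and ab: "a < b"
    and cf: "continuous_on {a..b} f" and m: "\<And>x. x \<in> {a..b} \<Longrightarrow> f b \<le> f x"
    and d: "d > 0" and diff: "\<And>x. x \<in> {b - d<..<b} \<inter> {a<..<b} \<Longrightarrow> f differentiable (at x)"
    and lim: "filterlim (\<lambda>x. \<bar>deriv f x\<bar> / (f x - f b) powr (1 / q)) at_top (at_left b)"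
    and N: "N > 0"
  shows "\<exists>r>0. \<forall>s\<in>{0<..<r}. (N * s) powr p \<le> f (b - s) - f b"
proof -
  have "eventually (\<lambda>x. p * N \<le> \<bar>deriv f x\<bar> / (f x - f b) powr (1 / q)) (at_left b)"
    using lim by (simp add: filterlim_at_top)
  then obtain e where e: "e < b"
    "\<And>x. e < x \<Longrightarrow> x < b \<Longrightarrow> p * N \<le> \<bar>deriv f x\<bar> / (f x - f b) powr (1 / q)"
    by (auto simp: eventually_at_left[OF ab])
  define r where "r = min (b - e) (min d (b - a))"
  have r: "r > 0" "r \<le> b - e" "r \<le> d" "r \<le> b - a" using e d ab by (auto simp: r_def)
  have pN: "p * N > 0" using p N by simp
  have pos: "f x > f b" if x: "b - r < x" "x < b" for x
  proof (rule ccontr)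
    assume "\<not> f x > f b"
    then have "f x = f b" using m[of x] x r by force
    \<comment> \<open>At a zero of \<open>f x - f b\<close> the quotient is 0 by the convention for
      division by zero, yet it is at least \<open>p * N > 0\<close>.\<close>
    then show False using e(2)[of x] x r pN by simp
  qed
  define g where "g x = (f x - f b) powr (1 / p)" for x
  have steep: "N * s \<le> g (b - s)" if s: "s \<in> {0<..<r}" for s
  proof -
    have "continuous_on {b - s..b} (\<lambda>x. f x - f b)"
      using s r by (intro continuous_intros continuous_on_subset[OF cf]) auto
    then have cg: "continuous_on {b - s..b} g"
      unfolding g_def using s r p m by (intro continuous_on_powr') (auto intro!: continuous_intros)
    have dg: "(g has_real_derivative (1 / p) * (f x - f b) powr (1 / p - 1) * deriv f x) (at x)"
      if x: "b - s < x" "x < b" for x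
    proof -
      have "f differentiable (at x)" using x s r by (intro diff) auto
      then have "(f has_real_derivative deriv f x) (at x)"
        by (simp add: DERIV_deriv_iff_real_differentiable)
      moreover have "f x - f b > 0" using pos[of x] x s by auto
      ultimately show ?thesis
        unfolding g_def by (auto intro!: derivative_eq_intros simp: field_simps powr_diff)
    qed
    obtain l z where z: "b - s < z" "z < b" "(g has_real_derivative l) (at z)" "g b - g (b - s) = s * l"
      using MVT[OF _ cg] dg s by (auto simp: real_differentiable_def)
    have l: "l = (1 / p) * (f z - f b) powr (1 / p - 1) * deriv f z"
      using DERIV_unique[OF z(3) dg[OF z(1,2)]] .
    have "1 / p - 1 = - (1 / q)" using pq by linarith
    then have "\<bar>l\<bar> = (\<bar>deriv f z\<bar> / (f z - f b) powr (1 / q)) / p"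
      unfolding l \<open>1 / p - 1 = - (1 / q)\<close> powr_minus using p by (simp add: abs_mult divide_inverse)
    also have "\<dots> \<ge> (p * N) / p"
      using z s r p by (intro divide_right_mono e(2)) auto
    finally have lN: "N \<le> \<bar>l\<bar>" using p by simp
    \<comment> \<open>The sign of \<open>l\<close> is unknown; \<open>g b = 0\<close> and
      \<open>g \<ge> 0\<close> settle it.\<close>
    have "g (b - s) = s * \<bar>l\<bar>"
    proof -
      have "g b = 0" by (simp add: g_def)
      then have "\<bar>g (b - s)\<bar> = \<bar>s * l\<bar>" using z(4) by simp
      then show ?thesis using s by (simp add: abs_mult g_def)
    qed
    then show ?thesis using lN s by (simp add: mult.commute)
  qed
  have "(N * s) powr p \<le> f (b - s) - f b" if s: "s \<in> {0<..<r}" for s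
  proof -
    have "(N * s) powr p \<le> g (b - s) powr p"
      using steep[OF s] s N p by (intro powr_mono2) auto
    also have "\<dots> = f (b - s) - f b"
      using pos[of "b - s"] s p by (simp add: g_def powr_powr)
    finally show ?thesis .
  qed
  then show ?thesis using r(1) by blast
qed

text \<open>At a point whose distance from \<open>b\<close> lies between \<open>\<rho> / 2\<close>
  and \<open>3 / 2 * \<rho>\<close>, \<open>f - f b\<close> is at most
  \<open>T * \<rho> powr p\<close> by the equation and at least
  \<open>(T + 1) powr p * \<rho> powr p\<close> by steepness.\<close>

lemma not_semiconcave_if_steep_right:
  assumes p: "1 < p" "p \<le> 2" and pq: "1 / p + 1 / q = 1" and ab: "a < b"
    and cf: "continuous_on {a..b} f" and m: "\<And>x. x \<in> {a..b} \<Longrightarrow> f b \<le> f x"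
    and d: "d > 0" and diff: "\<And>x. x \<in> {b - d<..<b} \<inter> {a<..<b} \<Longrightarrow> f differentiable (at x)"
    and lim: "filterlim (\<lambda>x. \<bar>deriv f x\<bar> / (f x - f b) powr (1 / q)) at_top (at_left b)"
    and sol: "constrained_viscosity_solution p f a b u"
  shows "\<not> semiconcave_on {a<..<b} u"
proof
  assume "semiconcave_on {a<..<b} u"
  then obtain K where K: "K \<ge> 0" and
    Ku: "\<And>x h. {x + s * h |s. - 1 \<le> s \<and> s \<le> 1} \<subseteq> {a<..<b} \<Longrightarrow>
        u (x + h) + u (x - h) - 2 * u x \<le> K * \<bar>h\<bar>\<^sup>2"
    unfolding semiconcave_on_def by blast
  have cu: "continuous_on {a..b} u"
    using sol by (simp add: constrained_viscosity_solution_def)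
  have um: "f b \<le> u x" if "x \<in> {a..b}" for x
    using viscosity_solution_ge[OF sol ab m that] .
  have ub: "u b = f b"
    using um[of b] viscosity_solution_le[OF sol ab cf, of b] ab by simp
  define M where "M = K / 2"
  have M: "M \<ge> 0" using K by (simp add: M_def)
  have uM: "u (b - s) - f b \<le> M * s\<^sup>2" if "0 \<le> s" "s \<le> b - a" for s
    unfolding M_def
  proof (rule parabola_bound_from_halving[OF K _ _ that, of "\<lambda>s. u (b - s) - f b"])
    show "u (b - s) - f b \<le> 2 * (u (b - s / 2) - f b) + K * (s / 2)\<^sup>2"
      if "0 \<le> s" "s \<le> b - a" for s
      using semiconcave_halving_right[OF cu K Ku that] ub by (simp add: field_simps)
    show "\<exists>B r. r > 0 \<and> (\<forall>s\<in>{0..r}. u (b - s) - f b \<le> c * s + B * s\<^sup>2)" if "c > 0" for c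
      using viscosity_solution_slope_right[OF p(1) ab cf sol refl um ub that] .
  qed
  \<comment> \<open>\<open>u - \<phi>\<close> is at least
    \<open>f b + A * (\<rho> / 2)\<^sup>2\<close> at the ends of the window and at most
    \<open>f b + M * \<rho>\<^sup>2\<close> at \<open>y\<close>; this \<open>A\<close> puts the
    minimizer inside.\<close>
  define A where "A = 4 * M + 1"
  have A: "A > 0" using M by (simp add: A_def)
  \<comment> \<open>The terms come from \<open>M * (3 / 2 * \<rho>)\<^sup>2\<close> and from the
    slope bound \<open>A * \<rho>\<close>.\<close>
  define T where "T = 9 / 4 * M + A powr p"
  have T: "T \<ge> 0" using M by (simp add: T_def)
  \<comment> \<open>The factor 2 offsets \<open>s > \<rho> / 2\<close>, and
    \<open>(T + 1) powr p \<ge> T + 1 > T\<close> gives the contradiction.\<close>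
  obtain r where r: "r > 0" "\<And>s. s \<in> {0<..<r} \<Longrightarrow> (2 * (T + 1) * s) powr p \<le> f (b - s) - f b"
    using steep_root_lower_bound[OF p(1) pq ab cf m d diff lim, of "2 * (T + 1)"] T by auto
  define \<rho> where "\<rho> = min (r / 2) (min ((b - a) / 2) 1)"
  have \<rho>: "0 < \<rho>" "3 / 2 * \<rho> < r" "3 / 2 * \<rho> < b - a" "\<rho> \<le> 1"
    using r(1) ab by (auto simp: \<rho>_def min_def field_simps)
  define y where "y = b - \<rho>"
  define \<phi> where "\<phi> x = - A * (x - y)\<^sup>2" for x
  have "continuous_on {y - \<rho> / 2..y + \<rho> / 2} (\<lambda>x. u x - \<phi> x)"
    unfolding \<phi>_def using \<rho> by (intro continuous_intros continuous_on_subset[OF cu]) (auto simp: y_def)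
  then obtain x0 where x0: "x0 \<in> {y - \<rho> / 2..y + \<rho> / 2}"
    "\<And>x. x \<in> {y - \<rho> / 2..y + \<rho> / 2} \<Longrightarrow> u x0 - \<phi> x0 \<le> u x - \<phi> x"
    using continuous_attains_inf[of "{y - \<rho> / 2..y + \<rho> / 2}" "\<lambda>x. u x - \<phi> x"] \<rho> by force
  have "u y - f b \<le> M * \<rho>\<^sup>2" using uM[of \<rho>] \<rho> by (simp add: y_def)
  moreover have "M * \<rho>\<^sup>2 < A * (\<rho> / 2)\<^sup>2"
    using \<rho>(1) by (simp add: A_def power2_eq_square field_simps)
  moreover have x0ab: "x0 \<in> {a..b}" using x0(1) \<rho> by (auto simp: y_def)
  ultimately have "x0 \<noteq> y - \<rho> / 2" "x0 \<noteq> y + \<rho> / 2"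
    using x0(2)[of y] um[of x0] \<rho>(1) by (auto simp: \<phi>_def)
  then have x0i: "y - \<rho> / 2 < x0" "x0 < y + \<rho> / 2" using x0(1) by auto
  have vis: "f x0 \<le> u x0 + \<bar>- 2 * A * (x0 - y)\<bar> powr p"
  proof (rule viscosity_super[OF sol, of \<phi> "\<lambda>x. - 2 * A * (x - y)" x0
        "min (x0 - (y - \<rho> / 2)) (y + \<rho> / 2 - x0)"])
    show "(\<phi> has_real_derivative - 2 * A * (x - y)) (at x)" for x
      unfolding \<phi>_def by (auto intro!: derivative_eq_intros)
    show "u x0 - \<phi> x0 \<le> u x - \<phi> x"
      if "\<bar>x - x0\<bar> < min (x0 - (y - \<rho> / 2)) (y + \<rho> / 2 - x0)" for x
      using that by (intro x0(2)) auto
  qed (use x0i x0ab in \<open>auto intro!: continuous_intros\<close>)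
  define s where "s = b - x0"
  have s: "\<rho> / 2 < s" "s < 3 / 2 * \<rho>" using x0i by (auto simp: s_def y_def)
  have "\<bar>- 2 * A * (x0 - y)\<bar> = A * (2 * \<bar>x0 - y\<bar>)" using A by (simp add: abs_mult)
  also have "\<dots> \<le> A * \<rho>"
    using x0i A by (intro mult_left_mono) (auto simp: abs_if field_simps)
  finally have "\<bar>- 2 * A * (x0 - y)\<bar> powr p \<le> (A * \<rho>) powr p"
    using p by (intro powr_mono2) auto
  also have "\<dots> = A powr p * \<rho> powr p" using A \<rho> by (simp add: powr_mult)
  finally have slope: "\<bar>- 2 * A * (x0 - y)\<bar> powr p \<le> A powr p * \<rho> powr p" .
  have "u x0 - f b \<le> M * s\<^sup>2" using uM[of s] s \<rho> by (simp add: s_def)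
  also have "\<dots> \<le> M * (3 / 2 * \<rho>)\<^sup>2" using s \<rho> M by (intro mult_left_mono power_mono) auto
  also have "\<dots> = 9 / 4 * M * \<rho> powr 2" using \<rho> by (simp add: power2_eq_square powr_numeral)
  \<comment> \<open>Here \<open>p \<le> 2\<close> enters: since \<open>\<rho> \<le> 1\<close>, the
    square is absorbed into the power \<open>p\<close>.\<close>
  also have "\<dots> \<le> 9 / 4 * M * \<rho> powr p"
    using M p \<rho> by (intro mult_left_mono powr_mono') auto
  finally have "f x0 - f b \<le> T * \<rho> powr p"
    using vis slope by (simp add: T_def algebra_simps)
  moreover have "(2 * (T + 1) * s) powr p \<le> f x0 - f b"
    using r(2)[of s] s \<rho> by (simp add: s_def)
  moreover have "(T + 1) * \<rho> \<le> (T + 1) * (2 * s)"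
    using s T by (intro mult_left_mono) auto
  then have "((T + 1) * \<rho>) powr p \<le> (2 * (T + 1) * s) powr p"
    using T p \<rho> by (intro powr_mono2) (auto simp: algebra_simps)
  moreover have "((T + 1) * \<rho>) powr p = (T + 1) powr p * \<rho> powr p"
    using T \<rho> by (simp add: powr_mult)
  ultimately have "(T + 1) powr p * \<rho> powr p \<le> T * \<rho> powr p" by linarith
  then have "(T + 1) powr p \<le> T" using \<rho>(1) by simp
  moreover have "(T + 1) powr 1 \<le> (T + 1) powr p" using T p by (intro powr_mono) auto
  ultimately show False using T by simp
qed

section \<open>Reflection to the left end\<close>

text \<open>The equation sees the slope only through its modulus, so reflected test functions remain
  valid tests. Reflecting over an arbitrary \<open>S\<close> covers both the open and the closed
  interval.\<close>

lemma constrained_viscosity_solution_reflect: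
  assumes sol: "constrained_viscosity_solution p f a b u"
  shows "constrained_viscosity_solution p (\<lambda>x. f (- x)) (- b) (- a) (\<lambda>x. u (- x))"
proof -
  have cu: "continuous_on {a..b} u"
    using sol by (simp add: constrained_viscosity_solution_def)
  have C1: "C1_with_deriv_on (uminus ` S) (\<lambda>x. \<phi> (- x)) (\<lambda>x. - \<phi>' (- x))"
    if "C1_with_deriv_on S \<phi> \<phi>'" for S \<phi> \<phi>'
    unfolding C1_with_deriv_on_def
  proof (intro conjI ballI)
    fix x assume x: "x \<in> uminus ` S"
    then have "(\<phi> has_real_derivative \<phi>' (- x)) (at (- x) within uminus ` (uminus ` S))"
      using that by (auto simp: C1_with_deriv_on_def image_image)
    moreover have "(uminus has_real_derivative - 1) (at x within uminus ` S)"
      by (auto intro!: derivative_eq_intros)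
    ultimately show "((\<lambda>x. \<phi> (- x)) has_real_derivative - \<phi>' (- x)) (at x within uminus ` S)"
      using DERIV_image_chain[of \<phi> "\<phi>' (- x)" uminus x "uminus ` S" "- 1"] by (simp add: o_def)
  next
    show "continuous_on (uminus ` S) (\<lambda>x. - \<phi>' (- x))"
      using that unfolding C1_with_deriv_on_def
      by (intro continuous_intros continuous_on_compose2[of S \<phi>' _ uminus]) auto
  qed
  have Imax: "local_max_within (uminus ` S) (\<lambda>x. w (- x)) (- x0)" if "local_max_within S w x0" for S w x0
    using that unfolding local_max_within_def by (auto simp: abs_minus_commute)
  have Imin: "local_min_within (uminus ` S) (\<lambda>x. w (- x)) (- x0)" if "local_min_within S w x0" for S w x0
    using that unfolding local_min_within_def by (auto simp: abs_minus_commute)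
  show ?thesis
    unfolding constrained_viscosity_solution_def
  proof (intro conjI allI impI)
    show "continuous_on {- b..- a} (\<lambda>x. u (- x))"
      by (rule continuous_on_compose2[OF cu]) (auto intro!: continuous_intros)
  next
    fix \<phi> \<phi>' x0
    assume "C1_with_deriv_on {- b<..<- a} \<phi> \<phi>'" "local_max_within {- b<..<- a} (\<lambda>x. u (- x) - \<phi> x) x0"
    from C1[OF this(1)] Imax[OF this(2)]
    have "C1_with_deriv_on {a<..<b} (\<lambda>x. \<phi> (- x)) (\<lambda>x. - \<phi>' (- x))"
      "local_max_within {a<..<b} (\<lambda>x. u x - \<phi> (- x)) (- x0)" by simp_all
    then have "u (- x0) + \<bar>- \<phi>' (- (- x0))\<bar> powr p - f (- x0) \<le> 0"
      using sol unfolding constrained_viscosity_solution_def by blast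
    then show "u (- x0) + \<bar>\<phi>' x0\<bar> powr p - f (- x0) \<le> 0" by simp
  next
    fix \<phi> \<phi>' x0
    assume "C1_with_deriv_on {- b..- a} \<phi> \<phi>'" "local_min_within {- b..- a} (\<lambda>x. u (- x) - \<phi> x) x0"
    from C1[OF this(1)] Imin[OF this(2)]
    have "C1_with_deriv_on {a..b} (\<lambda>x. \<phi> (- x)) (\<lambda>x. - \<phi>' (- x))"
      "local_min_within {a..b} (\<lambda>x. u x - \<phi> (- x)) (- x0)" by simp_all
    then have "u (- x0) + \<bar>- \<phi>' (- (- x0))\<bar> powr p - f (- x0) \<ge> 0"
      using sol unfolding constrained_viscosity_solution_def by blast
    then show "u (- x0) + \<bar>\<phi>' x0\<bar> powr p - f (- x0) \<ge> 0" by simp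
  qed
qed

lemma semiconcave_on_reflect:
  assumes "semiconcave_on S g"
  shows "semiconcave_on (uminus ` S) (\<lambda>x. g (- x))"
proof -
  obtain K where K: "K \<ge> 0" and
    Kg: "\<And>x h. {x + s * h |s. - 1 \<le> s \<and> s \<le> 1} \<subseteq> S \<Longrightarrow> g (x + h) + g (x - h) - 2 * g x \<le> K * \<bar>h\<bar>\<^sup>2"
    using assms unfolding semiconcave_on_def by blast
  have "g (- (x + h)) + g (- (x - h)) - 2 * g (- x) \<le> K * \<bar>h\<bar>\<^sup>2"
    if sub: "{x + s * h |s. - 1 \<le> s \<and> s \<le> 1} \<subseteq> uminus ` S" for x h
  proof -
    have "{- x + s * - h |s. - 1 \<le> s \<and> s \<le> 1} \<subseteq> S"
    proof clarify
      fix s :: real assume "- 1 \<le> s" "s \<le> 1"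
      then have "x + s * h \<in> uminus ` S" using sub by blast
      then obtain t where "t \<in> S" "x + s * h = - t" by blast
      then show "- x + s * - h \<in> S" by (metis add.inverse_inverse minus_add_distrib mult_minus_right)
    qed
    from Kg[OF this] show ?thesis by (simp add: algebra_simps)
  qed
  then show ?thesis unfolding semiconcave_on_def using K by blast
qed

lemma not_semiconcave_if_steep_left:
  assumes p: "1 < p" "p \<le> 2" and pq: "1 / p + 1 / q = 1" and ab: "a < b"
    and cf: "continuous_on {a..b} f" and m: "\<And>x. x \<in> {a..b} \<Longrightarrow> f a \<le> f x"
    and d: "d > 0" and diff: "\<And>x. x \<in> {a<..<a + d} \<inter> {a<..<b} \<Longrightarrow> f differentiable (at x)"
    and lim: "filterlim (\<lambda>x. \<bar>deriv f x\<bar> / (f x - f a) powr (1 / q)) at_top (at_right a)"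
    and sol: "constrained_viscosity_solution p f a b u"
  shows "\<not> semiconcave_on {a<..<b} u"
proof
  assume "semiconcave_on {a<..<b} u"
  then have scr: "semiconcave_on {- b<..<- a} (\<lambda>x. u (- x))"
    using semiconcave_on_reflect by fastforce
  have der: "((\<lambda>x. f (- x)) has_real_derivative - deriv f (- x)) (at x)"
    if "x \<in> {- a - d<..<- a} \<inter> {- b<..<- a}" for x
  proof -
    have "f differentiable (at (- x))" using that by (intro diff) auto
    then have "(f has_real_derivative deriv f (- x)) (at (- x))"
      by (simp add: DERIV_deriv_iff_real_differentiable)
    then show ?thesis by (simp add: DERIV_mirror)
  qed
  have "\<not> semiconcave_on {- b<..<- a} (\<lambda>x. u (- x))"
  proof (rule not_semiconcave_if_steep_right[OF p pq _ _ _ d _ _ constrained_viscosity_solution_reflect[OF sol]])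
    show "continuous_on {- b..- a} (\<lambda>x. f (- x))"
      by (rule continuous_on_compose2[OF cf]) (auto intro!: continuous_intros)
    show "(\<lambda>x. f (- x)) differentiable (at x)" if "x \<in> {- a - d<..<- a} \<inter> {- b<..<- a}" for x
      using der[OF that] by (auto simp: real_differentiable_def)
    have lim': "filterlim (\<lambda>x. \<bar>deriv f (- x)\<bar> / (f (- x) - f (- (- a))) powr (1 / q)) at_top (at_left (- a))"
      using lim by (simp add: at_right_minus filterlim_filtermap)
    have ev: "eventually (\<lambda>x. x \<in> {max (- a - d) (- b)<..<- a}) (at_left (- a))"
      by (rule eventually_at_leftI[of "max (- a - d) (- b)"]) (use d ab in auto)
    \<comment> \<open>The derivative of the reflection is computed only where \<open>f\<close> is
      known to be differentiable, so the quotients are identified only close to the end, which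
      suffices for the limit.\<close>
    have "eventually (\<lambda>x. \<bar>deriv f (- x)\<bar> / (f (- x) - f (- (- a))) powr (1 / q)
        = \<bar>deriv (\<lambda>x. f (- x)) x\<bar> / (f (- x) - f (- (- a))) powr (1 / q)) (at_left (- a))"
      using ev
    proof eventually_elim
      case (elim x)
      then have "deriv (\<lambda>x. f (- x)) x = - deriv f (- x)" by (intro DERIV_imp_deriv der) auto
      then show ?case by simp
    qed
    from filterlim_cong[OF refl refl this] lim'
    show "filterlim (\<lambda>x. \<bar>deriv (\<lambda>x. f (- x)) x\<bar> / (f (- x) - f (- (- a))) powr (1 / q)) at_top (at_left (- a))"
      by blast
  qed (use ab m in auto)
  then show False using scr by contradiction
qed

section \<open>The flat and the steep case combined\<close>

theorem theorem4p1:
  fixes p q a b \<epsilon> :: real and f u :: "real \<Rightarrow> real"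
  assumes "1 < p" and "p \<le> 2" and "1 / p + 1 / q = 1"
    and "a < b"
    and "continuous_on {a..b} f" and "f \<in> W1_infinity {a<..<b}"
    and "semiconcave_on {a<..<b} f"
    and "\<forall>x\<in>{a..b}. f a \<le> f x" and "f a = f b"
    and "\<epsilon> > 0"
    and "\<forall>x\<in>({a<..<a + \<epsilon>} \<union> {b - \<epsilon><..<b}) \<inter> {a<..<b}. f differentiable (at x)"
    and "constrained_viscosity_solution p f a b u"
  shows "((\<forall>x\<in>({a<..<a + \<epsilon>} \<union> {b - \<epsilon><..<b}) \<inter> {a<..<b}. deriv f x = 0) \<longrightarrow>
            semiconcave_on {a<..<b} u) \<and>
         (filterlim (\<lambda>x. \<bar>deriv f x\<bar> / (f x - f b) powr (1 / q)) at_top (at_left b) \<or>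
          filterlim (\<lambda>x. \<bar>deriv f x\<bar> / (f x - f b) powr (1 / q)) at_top (at_right a) \<longrightarrow>
            \<not> semiconcave_on {a<..<b} u)"
proof (intro conjI impI)
  assume flat: "\<forall>x\<in>({a<..<a + \<epsilon>} \<union> {b - \<epsilon><..<b}) \<inter> {a<..<b}. deriv f x = 0"
  \<comment> \<open>\<open>deriv f x = 0\<close> carries information only together with
    differentiability.\<close>
  have der: "(f has_real_derivative 0) (at x)"
    if "x \<in> {a<..<b}" "x < a + \<epsilon> \<or> b - \<epsilon> < x" for x
  proof -
    have "x \<in> ({a<..<a + \<epsilon>} \<union> {b - \<epsilon><..<b}) \<inter> {a<..<b}" using that by auto
    then show ?thesis
      using flat assms(11) by (metis DERIV_deriv_iff_real_differentiable)
  qed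
  show "semiconcave_on {a<..<b} u"
  proof (rule semiconcave_solution_if_flat_near_ends[OF assms(1,4,5,7) _ assms(10) _ assms(12)])
    show "f x = f a" if x: "x \<in> {a..b}" "x < a + \<epsilon> \<or> b - \<epsilon> < x" for x
    proof (cases "x < a + \<epsilon>")
      case True
      show ?thesis
      proof (cases "x = a")
        case False
        show ?thesis
          by (rule DERIV_isconst_end[of a x f])
             (use x True False der in \<open>auto intro: continuous_on_subset[OF assms(5)]\<close>)
      qed simp
    next
      case False
      show ?thesis
      proof (cases "x = b")
        case nb: False
        have "f b = f x"
          by (rule DERIV_isconst_end[of x b f])
             (use x nb False der in \<open>auto intro: continuous_on_subset[OF assms(5)]\<close>)
        then show ?thesis using assms(9) by simp
      qed (use assms(9) in simp)
    qed
  qed (use assms(8) in blast)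
next
  assume "filterlim (\<lambda>x. \<bar>deriv f x\<bar> / (f x - f b) powr (1 / q)) at_top (at_left b) \<or>
          filterlim (\<lambda>x. \<bar>deriv f x\<bar> / (f x - f b) powr (1 / q)) at_top (at_right a)"
  then show "\<not> semiconcave_on {a<..<b} u"
  proof
    assume "filterlim (\<lambda>x. \<bar>deriv f x\<bar> / (f x - f b) powr (1 / q)) at_top (at_left b)"
    then show ?thesis
      using assms by (intro not_semiconcave_if_steep_right[where f = f and d = \<epsilon> and p = p and q = q]) auto
  next
    \<comment> \<open>The quotient is written with \<open>f b\<close>; \<open>f a = f b\<close>
      brings it to the form needed at \<open>a\<close>.\<close>
    assume "filterlim (\<lambda>x. \<bar>deriv f x\<bar> / (f x - f b) powr (1 / q)) at_top (at_right a)"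
    then show ?thesis
      using assms by (intro not_semiconcave_if_steep_left[where f = f and d = \<epsilon> and p = p and q = q]) auto
  qed
qed

end
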